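(* Let $0<|q|<1$. If $k$ is a positive even integer then \begin{align*} (q;q)_{\infty}^3&= \sum_{0\le \ell< \frac{k-1}{2}}(-1)^{\ell}q^{\frac{\ell(\ell+1)}{2}} \left(-q^{\frac{k(k-1-2\ell)}{2}},-q^{\frac{k(k+1+2\ell)}{2}},q^{k^2}; q^{k^2}\right)_{\infty}\\ &\quad\;\times\left(2\ell+1-2k\sum_{n\ge 0} \left(\frac{q^{k(kn+\frac{k-1-2\ell}{2})}} {1+q^{k(kn+\frac{k-1-2\ell}{2})}}- \frac{q^{k(kn+\frac{k+1+2\ell}{2})}} {1+q^{k(kn+\frac{k+1+2\ell}{2})}}\right)\right). \end{align*} If $k$ is a positive odd integer then \begin{align*} (q;q)_{\infty}^3&- (-1)^{\frac{k-1}{2}}kq^{\frac{k^2-1}{8}}(q^{k^2};q^{k^2})_{\infty}^3\\ &=\sum_{0\le \ell< \frac{k-1}{2}}(-1)^{\ell}q^{\frac{\ell(\ell+1)}{2}} \left(q^{\frac{k(k-1-2\ell)}{2}},q^{\frac{k(k+1+2\ell)}{2}},q^{k^2}; q^{k^2}\right)_{\infty}\\ &\quad\;\times\left(2\ell+1+2k\sum_{n\ge 0} \left(\frac{q^{k(kn+\frac{k-1-2\ell}{2})}} {1-q^{k(kn+\frac{k-1-2\ell}{2})}}- \frac{q^{k(kn+\frac{k+1+2\ell}{2})}} {1-q^{k(kn+\frac{k+1+2\ell}{2})}}\right)\right). \end{align*}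
   Context: For $a\in\mathbb{C}$ and $0<|q|<1$, $(a;q)_\infty=\prod_{j\ge0}(1-aq^j)$ and $(a_1,\ldots,a_m;q)_\infty=(a_1;q)_\infty\cdots(a_m;q)_\infty$. *)

theory Defs
  imports "HOL-Analysis.Analysis"
begin

definition qpoch_inf :: "complex \<Rightarrow> complex \<Rightarrow> complex" where
  "qpoch_inf a q = (\<Prod>j. 1 - a * q ^ j)"

definition qpoch_infs :: "complex list \<Rightarrow> complex \<Rightarrow> complex" where
  "qpoch_infs as q = (\<Prod>a\<leftarrow>as. qpoch_inf a q)"

text \<open>
  In the theorem, \<open>2 * l < k - 1\<close> and both \<open>k * (k - 1 - 2 * l)\<close> and \<open>k * (k + 1 + 2 * l)\<close>
  are even, so every natural subtraction and division in the following exponents is exact.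
  For even \<open>k\<close> the number \<open>k - 1 - 2 * l\<close> is odd, so the factor \<open>k\<close> has to be multiplied
  in before halving.
\<close>

definition exp_minus :: "nat \<Rightarrow> nat \<Rightarrow> nat" where
  "exp_minus k l = k * (k - 1 - 2 * l) div 2"

definition exp_plus :: "nat \<Rightarrow> nat \<Rightarrow> nat" where
  "exp_plus k l = k * (k + 1 + 2 * l) div 2"

end

theory Submission
  imports Defs
begin

text \<open>
  By Jacobi's identity, twice the cube of \<open>(q;q)\<close> is the sum of \<open>(-1)^n (2n+1) q^(n(n+1)/2)\<close> over all
  integers \<open>n\<close>. Split this sum by the residue \<open>r\<close> of \<open>n\<close> modulo \<open>k\<close>: the reflection \<open>n \<mapsto> -1-n\<close>
  identifies the classes of \<open>r\<close> and \<open>k-1-r\<close>, and for odd \<open>k\<close> the self-paired class \<open>(k-1)/2\<close> is again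
  a Jacobi sum, with base \<open>q^(k^2)\<close>. Any other class is a linear combination of the triple product
  series with base \<open>q^(k^2)\<close> and of its logarithmic derivative, which is the Lambert series.

  Both the triple product and its derivative are obtained as limits (Tannery) of their finite
  versions, whose coefficients are Gaussian binomials. The derivative enters only through the
  product rule on the finite products and the weight \<open>m\<close> on the coefficients, so no complex
  analysis is needed. Jacobi's identity is the case \<open>x = 1\<close> of the derivative.
\<close>

subsection \<open>Sums over the integers\<close>

text \<open>Tannery's theorem over Z: enumeration by \<open>int_decode\<close> reduces it to series
  over the naturals; the order is harmless because \<open>M\<close> gives absolute
  summability.\<close>

lemma has_sum_limit_int:
  fixes f :: "nat \<Rightarrow> int \<Rightarrow> complex"
  assumes sums: "\<And>n. (f n has_sum S n) UNIV"
    and lim: "\<And>m. (\<lambda>n. f n m) \<longlonglongrightarrow> g m"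
    and bound: "\<And>n m. norm (f n m) \<le> M m"
    and M: "M summable_on UNIV"
    and S: "S \<longlonglongrightarrow> s"
  shows "(g has_sum s) UNIV"
proof -
  have M_nonneg: "0 \<le> M m" for m
    using bound[of 0 m] norm_ge_zero order_trans by blast
  have g_bound: "norm (g m) \<le> M m" for m
    by (rule Lim_bounded[OF tendsto_norm[OF lim], of 0]) (use bound in auto)
  have g_sum: "g summable_on UNIV"
    by (rule abs_summable_summable, rule Infinite_Sum.abs_summable_on_comparison_test[where g = M])
       (use M M_nonneg g_bound in auto)
  have "(\<lambda>k. M (int_decode k)) summable_on UNIV"
    using M summable_on_reindex_bij_betw[OF bij_int_decode, of M] by simp
  hence M_summable: "summable (\<lambda>k. M (int_decode k))"
    by (rule summable_on_imp_summable)
  have f_sums: "(\<lambda>k. f n (int_decode k)) sums S n" for n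
    using sums[of n] has_sum_reindex_bij_betw[OF bij_int_decode, of "f n" "S n"]
    by (auto intro: has_sum_imp_sums)
  have "((\<lambda>k. g (int_decode k)) has_sum infsum g UNIV) UNIV"
    using g_sum has_sum_reindex_bij_betw[OF bij_int_decode, of g] by simp
  hence g_sums: "(\<lambda>k. g (int_decode k)) sums infsum g UNIV"
    by (rule has_sum_imp_sums)
  have "(\<lambda>n. \<Sum>k. f n (int_decode k)) \<longlonglongrightarrow> (\<Sum>k. g (int_decode k))"
    using tannerys_theorem[of "\<lambda>k n. f n (int_decode k)" "\<lambda>k. g (int_decode k)" sequentially
        "\<lambda>k. M (int_decode k)"] lim bound M_summable
    by (simp add: always_eventually)
  hence "S \<longlonglongrightarrow> infsum g UNIV"
    using f_sums g_sums by (simp add: sums_iff)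
  hence "infsum g UNIV = s"
    using S LIMSEQ_unique by blast
  thus ?thesis
    using g_sum by auto
qed

section \<open>Theta coefficients and their summable majorant\<close>

lemma summable_on_int_halves:
  fixes f :: "int \<Rightarrow> real"
  assumes "summable (\<lambda>n. f (int n))" "summable (\<lambda>n. f (- int n))" "\<And>m. 0 \<le> f m"
  shows "f summable_on UNIV"
proof -
  have "(\<lambda>n. f (int n)) summable_on UNIV" "(\<lambda>n. f (- int n)) summable_on UNIV"
    using assms by (auto intro: summable_nonneg_imp_summable_on)
  hence "f summable_on range int" "f summable_on range (\<lambda>n. - int n)"
    by (subst summable_on_reindex; simp add: inj_on_def o_def)+
  moreover have "range int \<union> range (\<lambda>n. - int n) = UNIV"
  proof -
    have "m \<in> range int \<union> range (\<lambda>n. - int n)" for m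
      by (cases m rule: int_cases2) auto
    thus ?thesis by auto
  qed
  ultimately show ?thesis
    by (metis summable_on_union)
qed

text \<open>Ratio test: as \<open>2 + n \<le> 2 * (1 + n)\<close>, consecutive terms have quotient
  at most \<open>2 * (r ^ n * R)\<close>, which tends to 0.\<close>

lemma summable_gaussian_nat:
  fixes r R :: real
  assumes "0 < r" "r < 1" "0 < R"
  shows "summable (\<lambda>n. (1 + real n) * r ^ (n * (n - 1) div 2) * R ^ n)"
proof -
  define f where "f n = (1 + real n) * r ^ (n * (n - 1) div 2) * R ^ n" for n
  have "(\<lambda>n. 2 * (r ^ n * R)) \<longlonglongrightarrow> 2 * (0 * R)"
    using assms by (intro tendsto_intros LIMSEQ_realpow_zero) auto
  hence "\<forall>\<^sub>F n in sequentially. 2 * (r ^ n * R) < 1 / 2"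
    by (rule order_tendstoD(2)) simp
  then obtain N where N: "2 * (r ^ n * R) < 1 / 2" if "n \<ge> N" for n
    by (auto simp: eventually_at_top_linorder)
  have "norm (f (Suc n)) \<le> 1 / 2 * norm (f n)" if "n \<ge> N" for n
  proof -
    have "Suc n * (Suc n - 1) = n * (n - 1) + n * 2"
      by (cases n) auto
    hence "Suc n * (Suc n - 1) div 2 = n * (n - 1) div 2 + n"
      by simp
    hence "f (Suc n) = (2 + real n) * (r ^ n * R) * (r ^ (n * (n - 1) div 2) * R ^ n)"
      by (simp add: f_def power_add)
    also have "\<dots> \<le> (2 * (1 + real n)) * (r ^ n * R) * (r ^ (n * (n - 1) div 2) * R ^ n)"
      using assms by (intro mult_right_mono) auto
    also have "\<dots> = 2 * (r ^ n * R) * f n"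
      by (simp add: f_def)
    also have "\<dots> \<le> 1 / 2 * f n"
      using N[OF that] assms by (intro mult_right_mono) (auto simp: f_def)
    finally show ?thesis
      using assms by (simp add: f_def)
  qed
  hence "summable f"
    by (intro summable_ratio_test[of "1 / 2" N]) auto
  thus ?thesis
    by (simp add: f_def[abs_def])
qed

lemma has_sum_diff:
  fixes f g :: "'a \<Rightarrow> 'b :: topological_ab_group_add"
  assumes "(f has_sum a) A" "(g has_sum b) A"
  shows "((\<lambda>x. f x - g x) has_sum (a - b)) A"
  using has_sum_add[OF assms(1), of "\<lambda>x. - g x" "- b"] assms(2) by (simp add: has_sum_uminus)

text \<open>The coefficient of \<open>x^m\<close> in the triple product series; the halving is exact
  because \<open>m\<close> and \<open>m - 1\<close> are consecutive.\<close>

definition theta_coeff :: "complex \<Rightarrow> int \<Rightarrow> complex" where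
  "theta_coeff Q m = (-1) powi m * Q powi (m * (m - 1) div 2)"

lemma theta_coeff_step:
  assumes "Q \<noteq> 0"
  shows "theta_coeff Q (m + 1) = - (Q powi m) * theta_coeff Q m"
proof -
  have "(m + 1) * (m + 1 - 1) = m * (m - 1) + m * 2"
    by (simp add: algebra_simps)
  hence "(m + 1) * (m + 1 - 1) div 2 = m * (m - 1) div 2 + m"
    by simp
  thus ?thesis
    using assms by (simp add: theta_coeff_def power_int_add)
qed

text \<open>The weight \<open>1 + |m|\<close> dominates both 1 and \<open>|m|\<close>, so one
  majorant serves the series and its derivative.\<close>

lemma theta_majorant_summable:
  fixes Q x :: complex
  assumes "Q \<noteq> 0" "norm Q < 1" "x \<noteq> 0"
  shows "(\<lambda>m. (1 + real_of_int \<bar>m\<bar>) * norm (theta_coeff Q m * x powi m)) summable_on UNIV"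
proof (rule summable_on_int_halves)
  have nat_exp: "int n * (int n - 1) div 2 = int (n * (n - 1) div 2)" for n
    by (cases n) (auto simp: zdiv_int algebra_simps)
  have pos: "norm (theta_coeff Q (int n) * x powi int n) = norm Q ^ (n * (n - 1) div 2) * norm x ^ n" for n
    by (simp only: theta_coeff_def nat_exp) (simp add: norm_mult norm_power norm_power_int)
  \<comment> \<open>The extra \<open>n\<close> in the exponent moves into the base, so the negative
    half is the same Gaussian series with \<open>R = |Q| / |x|\<close>.\<close>
  have neg_exp: "(- int n) * (- int n - 1) div 2 = int (n * (n - 1) div 2 + n)" for n
  proof -
    have "(- int n) * (- int n - 1) = int n * (int n - 1) + int n * 2"
      by (simp add: algebra_simps)
    thus ?thesis
      using nat_exp[of n] by simp
  qed
  have neg: "norm (theta_coeff Q (- int n) * x powi (- int n)) =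
      norm Q ^ (n * (n - 1) div 2) * (norm Q / norm x) ^ n" for n
    by (simp only: theta_coeff_def neg_exp power_int_of_nat power_int_minus)
       (simp add: norm_mult norm_power power_add norm_inverse power_divide divide_inverse power_mult_distrib power_inverse)
  show "summable (\<lambda>n. (1 + real_of_int \<bar>int n\<bar>) * norm (theta_coeff Q (int n) * x powi int n))"
    using summable_gaussian_nat[of "norm Q" "norm x"] assms by (simp only: pos) (simp add: mult.assoc)
  show "summable (\<lambda>n. (1 + real_of_int \<bar>- int n\<bar>) * norm (theta_coeff Q (- int n) * x powi (- int n)))"
    using summable_gaussian_nat[of "norm Q" "norm Q / norm x"] assms by (simp only: neg) (simp add: mult.assoc)
qed simp

subsection \<open>The finite triple product\<close>

definition qfact :: "complex \<Rightarrow> nat \<Rightarrow> complex" where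
  "qfact Q n = (\<Prod>j<n. 1 - Q ^ Suc j)"

text \<open>Vanishing at negative arguments makes \<open>inv_qfact_step\<close> hold for all integers, so the
  recurrence for the Gaussian binomials needs no boundary cases.\<close>

definition inv_qfact :: "complex \<Rightarrow> int \<Rightarrow> complex" where
  "inv_qfact Q n = (if n < 0 then 0 else inverse (qfact Q (nat n)))"

text \<open>The Gaussian binomial of \<open>2N\<close> over \<open>N + m\<close>. It is zero for
  \<open>|m| > N\<close>, so sums over all integers \<open>m\<close> are finite.\<close>

definition central_qbinom :: "complex \<Rightarrow> nat \<Rightarrow> int \<Rightarrow> complex" where
  "central_qbinom Q N m = qfact Q (2 * N) * inv_qfact Q (int N + m) * inv_qfact Q (int N - m)"

lemma power_neq_one:
  fixes Q :: complex
  assumes "norm Q < 1"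
  shows "Q ^ Suc n \<noteq> 1"
proof
  assume "Q ^ Suc n = 1"
  hence "norm Q ^ Suc n = 1"
    by (metis norm_one norm_power)
  moreover have "norm Q ^ Suc n < 1"
    using power_less_one_iff[of "norm Q" "Suc n"] assms by (simp del: power_Suc)
  ultimately show False
    by simp
qed

lemma qfact_nonzero: "norm Q < 1 \<Longrightarrow> qfact Q n \<noteq> 0"
  unfolding qfact_def using power_neq_one[of Q] by (auto simp del: power_Suc) 

lemma inv_qfact_step:
  assumes "norm Q < 1"
  shows "inv_qfact Q n = (1 - Q powi (n + 1)) * inv_qfact Q (n + 1)"
proof (cases "n \<ge> 0")
  case True
  then obtain i where i: "n = int i"
    using zero_le_imp_eq_int by blast
  have "qfact Q (Suc i) = qfact Q i * (1 - Q ^ Suc i)"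
    by (simp add: qfact_def)
  moreover have "Q powi (n + 1) = Q ^ Suc i"
    unfolding i by (metis of_nat_Suc add.commute power_int_of_nat)
  moreover have "nat (n + 1) = Suc i"
    using i by simp
  ultimately show ?thesis
    using qfact_nonzero[OF assms] power_neq_one[OF assms, of i] i
    by (simp add: inv_qfact_def divide_simps)
next
  case False
  \<comment> \<open>At \<open>n = -1\<close> the factor \<open>1 - Q powi 0\<close> vanishes;
    further down both reciprocals are 0.\<close>
  then consider "n = -1" | "n < -1" by linarith
  thus ?thesis
    by cases (auto simp: inv_qfact_def)
qed

lemma central_qbinom_step:
  assumes Q: "Q \<noteq> 0" "norm Q < 1"
  shows "central_qbinom Q (Suc N) m =
    (1 + Q ^ (2 * N + 1)) * central_qbinom Q N m
    + Q powi (int N - m + 1) * central_qbinom Q N (m - 1)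
    + Q powi (int N + m + 1) * central_qbinom Q N (m + 1)"
proof -
  \<comment> \<open>\<open>r\<close> and \<open>s\<close> are the reciprocals of largest argument.
    All others are polynomial multiples of them, which leaves a polynomial identity in
    \<open>A\<close>, \<open>B\<close> and \<open>Q\<close>.\<close>
  define A B r s where "A = Q powi (int N + m)" "B = Q powi (int N - m)"
    "r = inv_qfact Q (int N + m + 1)" "s = inv_qfact Q (int N - m + 1)"
  note defs = this
  have AB: "Q ^ (2 * N) = A * B"
    using Q by (simp add: defs flip: power_int_add power_int_of_nat)
  have A: "Q powi (int N + m + 1) = A * Q" and B: "Q powi (int N - m + 1) = B * Q"
    using Q by (simp_all add: defs power_int_add)
  have a0: "inv_qfact Q (int N + m) = (1 - A * Q) * r"
    using inv_qfact_step[OF Q(2), of "int N + m"] by (simp add: A defs)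
  have a1: "inv_qfact Q (int N + (m - 1)) = (1 - A) * ((1 - A * Q) * r)"
    using inv_qfact_step[OF Q(2), of "int N + (m - 1)"]
    unfolding a0[symmetric] by (simp add: defs(1))
  have b0: "inv_qfact Q (int N - m) = (1 - B * Q) * s"
    using inv_qfact_step[OF Q(2), of "int N - m"] by (simp add: B defs)
  have b1: "inv_qfact Q (int N - (m + 1)) = (1 - B) * ((1 - B * Q) * s)"
    using inv_qfact_step[OF Q(2), of "int N - (m + 1)"]
    unfolding b0[symmetric] by (simp add: defs(2))
  have a2: "inv_qfact Q (int N + (m + 1)) = r" "inv_qfact Q (int N - (m - 1)) = s"
    "inv_qfact Q (int (Suc N) + m) = r" "inv_qfact Q (int (Suc N) - m) = s"
    by (simp_all add: defs algebra_simps)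
  have P: "qfact Q (2 * Suc N) = qfact Q (2 * N) * (1 - A * B * Q) * (1 - A * B * Q * Q)"
    by (simp add: qfact_def mult_ac flip: AB)
  show ?thesis
    unfolding central_qbinom_def a0 a1 b0 b1 a2 P A B
    by (simp add: AB power_add) algebra
qed

definition triple_partial :: "complex \<Rightarrow> complex \<Rightarrow> nat \<Rightarrow> complex" where
  "triple_partial Q x N = (\<Prod>j<N. (1 - x * Q ^ j) * (1 - Q / x * Q ^ j))"

text \<open>This is \<open>x\<close> times the derivative of \<open>triple_partial Q x N\<close> with respect to \<open>x\<close>, computed by
  the product rule.\<close>

primrec triple_partial_deriv :: "complex \<Rightarrow> complex \<Rightarrow> nat \<Rightarrow> complex" where
  "triple_partial_deriv Q x 0 = 0"
| "triple_partial_deriv Q x (Suc N) =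
    triple_partial_deriv Q x N * ((1 - x * Q ^ N) * (1 - Q / x * Q ^ N))
    + triple_partial Q x N * (Q / x * Q ^ N - x * Q ^ N)"

definition triple_term :: "complex \<Rightarrow> complex \<Rightarrow> nat \<Rightarrow> int \<Rightarrow> complex" where
  "triple_term Q x N m = central_qbinom Q N m * (theta_coeff Q m * x powi m)"

text \<open>Quotients of neighbouring theta coefficients cancel the dependence on \<open>m\<close>
  in the recurrence of the binomials. What remains are the coefficients of
  \<open>(1 - x Q^N) (1 - Q^(N+1) / x)\<close>.\<close>

lemma triple_term_step:
  assumes Q: "Q \<noteq> 0" "norm Q < 1" and x: "x \<noteq> 0"
  shows "triple_term Q x (Suc N) m = (1 + Q ^ (2 * N + 1)) * triple_term Q x N m
    - x * Q ^ N * triple_term Q x N (m - 1) - Q / x * Q ^ N * triple_term Q x N (m + 1)"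
proof -
  have "theta_coeff Q m = - (Q powi (m - 1)) * theta_coeff Q (m - 1)"
    using theta_coeff_step[OF Q(1), of "m - 1"] by simp
  hence 1: "theta_coeff Q (m - 1) = - (Q powi (1 - m)) * theta_coeff Q m"
    using Q by (simp add: power_int_diff)
  have 2: "x * x powi (m - 1) = x powi m" "x powi (m + 1) = x powi m * x"
    using x by (simp_all add: power_int_diff power_int_add)
  have 3: "Q powi (int N - m + 1) = Q powi (1 - m) * Q ^ N"
    "Q powi (int N + m + 1) = Q powi m * Q * Q ^ N"
    using Q by (simp_all add: power_int_diff power_int_add)
  have "x * Q ^ N * triple_term Q x N (m - 1)
      = - (Q powi (1 - m)) * Q ^ N * central_qbinom Q N (m - 1) * theta_coeff Q m * x powi m"
    unfolding triple_term_def 1 2(1)[symmetric] by (simp add: algebra_simps)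
  moreover have "Q / x * Q ^ N * triple_term Q x N (m + 1)
      = - (Q powi m * Q * Q ^ N) * central_qbinom Q N (m + 1) * theta_coeff Q m * x powi m"
    unfolding triple_term_def 2(2) theta_coeff_step[OF Q(1)] using x by (simp add: field_simps)
  ultimately show ?thesis
    unfolding triple_term_def central_qbinom_step[OF Q] 3 by (simp add: algebra_simps)
qed

lemma has_sum_shift_int:
  fixes f :: "int \<Rightarrow> 'a :: {comm_monoid_add,topological_space}"
  shows "((\<lambda>m. f (m + c)) has_sum S) UNIV \<longleftrightarrow> (f has_sum S) UNIV"
  by (rule has_sum_reindex_bij_witness[where i = "\<lambda>m. m - c" and j = "\<lambda>m. m + c"]) auto

text \<open>The finite triple product identity and its derivative, by induction:
  \<open>triple_term_step\<close> is multiplication by the next pair of factors.\<close>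

lemma triple_partial_has_sum:
  assumes Q: "Q \<noteq> 0" "norm Q < 1" and x: "x \<noteq> 0"
  shows "(triple_term Q x N has_sum triple_partial Q x N) UNIV" (is ?sum)
    and "((\<lambda>m. of_int m * triple_term Q x N m) has_sum triple_partial_deriv Q x N) UNIV" (is ?wsum)
proof -
  have "?sum \<and> ?wsum"
  proof (induction N)
    case 0
    \<comment> \<open>Unless \<open>m = 0\<close>, one of \<open>m\<close> and \<open>-m\<close> is
      negative and its reciprocal factorial is 0.\<close>
    have zero: "triple_term Q x 0 m = (if m = 0 then 1 else 0)" for m
      by (auto simp: triple_term_def central_qbinom_def inv_qfact_def qfact_def theta_coeff_def)
    have "(triple_term Q x 0 has_sum 1) UNIV"
      by (rule has_sum_finite_neutralI[where B = "{0}"]) (auto simp: zero)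
    moreover have "((\<lambda>m. of_int m * triple_term Q x 0 m) has_sum 0) UNIV"
      by (rule has_sum_finite_neutralI[where B = "{0}"]) (auto simp: zero)
    ultimately show ?case
      by (simp add: triple_partial_def)
  next
    case (Suc N)
    let ?F = "triple_partial Q x N" and ?G = "triple_partial_deriv Q x N"
    let ?f = "triple_term Q x N"
    define u v where "u = x * Q ^ N" "v = Q / x * Q ^ N"
    have step: "triple_term Q x (Suc N) m = (1 + u * v) * ?f m - u * ?f (m - 1) - v * ?f (m + 1)" for m
      using x unfolding triple_term_step[OF Q x] by (simp add: u_v_def power_add mult_2)
    have F: "(?f has_sum ?F) UNIV" and G: "((\<lambda>m. of_int m * ?f m) has_sum ?G) UNIV"
      using Suc.IH by auto
    have Fm: "((\<lambda>m. ?f (m - 1)) has_sum ?F) UNIV" and Fp: "((\<lambda>m. ?f (m + 1)) has_sum ?F) UNIV"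
      using F has_sum_shift_int[of ?f "-1"] has_sum_shift_int[of ?f 1] by simp_all
    have Gm: "((\<lambda>m. of_int (m - 1) * ?f (m - 1)) has_sum ?G) UNIV"
      and Gp: "((\<lambda>m. of_int (m + 1) * ?f (m + 1)) has_sum ?G) UNIV"
      using G has_sum_shift_int[of "\<lambda>m. of_int m * ?f m" "-1"]
        has_sum_shift_int[of "\<lambda>m. of_int m * ?f m" 1] by simp_all
    have "((\<lambda>m. (1 + u * v) * ?f m - u * ?f (m - 1) - v * ?f (m + 1)) has_sum
        ((1 + u * v) * ?F - u * ?F - v * ?F)) UNIV"
      by (intro has_sum_diff has_sum_cmult_right F Fm Fp)
    also have "(1 + u * v) * ?F - u * ?F - v * ?F = ?F * ((1 - u) * (1 - v))"
      by (simp add: algebra_simps)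
    also have "\<dots> = triple_partial Q x (Suc N)"
      by (simp add: triple_partial_def u_v_def)
    also have "(\<lambda>m. (1 + u * v) * ?f m - u * ?f (m - 1) - v * ?f (m + 1)) = triple_term Q x (Suc N)"
      by (simp add: fun_eq_iff step)
    finally have 1: "(triple_term Q x (Suc N) has_sum triple_partial Q x (Suc N)) UNIV" .
    \<comment> \<open>On the shifted terms the weight \<open>m\<close> is split as
      \<open>(m - 1) + 1\<close> and \<open>(m + 1) - 1\<close>, so that \<open>Gm\<close> and
      \<open>Gp\<close> apply. The leftovers give the product rule term
      \<open>?F * (v - u)\<close>.\<close>
    have "((\<lambda>m. (1 + u * v) * (of_int m * ?f m)
          - u * (of_int (m - 1) * ?f (m - 1) + ?f (m - 1))
          - v * (of_int (m + 1) * ?f (m + 1) - ?f (m + 1))) has_sum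
        ((1 + u * v) * ?G - u * (?G + ?F) - v * (?G - ?F))) UNIV"
      by (intro has_sum_diff has_sum_add has_sum_cmult_right F Fm Fp G Gm Gp)
    also have "(1 + u * v) * ?G - u * (?G + ?F) - v * (?G - ?F) = ?G * ((1 - u) * (1 - v)) + ?F * (v - u)"
      by (simp add: algebra_simps)
    also have "\<dots> = triple_partial_deriv Q x (Suc N)"
      by (simp add: u_v_def)
    also have "(\<lambda>m. (1 + u * v) * (of_int m * ?f m)
          - u * (of_int (m - 1) * ?f (m - 1) + ?f (m - 1))
          - v * (of_int (m + 1) * ?f (m + 1) - ?f (m + 1)))
        = (\<lambda>m. of_int m * triple_term Q x (Suc N) m)"
      unfolding step by (rule ext) (simp add: algebra_simps)
    finally show ?case
      using 1 by blast
  qed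
  thus ?sum ?wsum
    by auto
qed

subsection \<open>Passage to the limit\<close>

lemma convergent_prod_qpoch:
  assumes "norm (Q :: complex) < 1"
  shows "convergent_prod (\<lambda>j. 1 - a * Q ^ j)"
proof -
  have "summable (\<lambda>j. norm a * norm Q ^ j)"
    using assms by (intro summable_mult summable_geometric) auto
  hence "abs_convergent_prod (\<lambda>j. 1 - a * Q ^ j)"
    by (intro summable_imp_abs_convergent_prod) (simp add: norm_mult norm_power)
  thus ?thesis
    by (rule abs_convergent_prod_imp_convergent_prod)
qed

lemma qpoch_inf_LIMSEQ:
  assumes "norm Q < 1"
  shows "(\<lambda>N. \<Prod>j<N. 1 - a * Q ^ j) \<longlonglongrightarrow> qpoch_inf a Q"
  using convergent_prod_LIMSEQ[OF convergent_prod_qpoch[OF assms, of a]]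
  unfolding qpoch_inf_def by (subst (asm) LIMSEQ_lessThan_iff_atMost[symmetric]) 

lemma qfact_LIMSEQ: "norm Q < 1 \<Longrightarrow> qfact Q \<longlonglongrightarrow> qpoch_inf Q Q"
  using qpoch_inf_LIMSEQ[of Q Q] by (simp add: qfact_def[abs_def])

lemma qpoch_inf_self_nonzero:
  assumes "norm Q < 1"
  shows "qpoch_inf Q Q \<noteq> 0"
  unfolding qpoch_inf_def
  using convergent_prod_qpoch[OF assms, of Q] power_neq_one[OF assms]
  by (intro prodinf_nonzero) auto

lemma inv_qfact_LIMSEQ:
  assumes "norm Q < 1" "filterlim f at_top sequentially"
  shows "(\<lambda>N. inv_qfact Q (f N)) \<longlonglongrightarrow> inverse (qpoch_inf Q Q)"
proof -
  have "filterlim (\<lambda>N. nat (f N)) at_top sequentially"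
    using assms(2) filterlim_compose filterlim_nat_sequentially by blast
  hence "(\<lambda>N. inverse (qfact Q (nat (f N)))) \<longlonglongrightarrow> inverse (qpoch_inf Q Q)"
    by (intro tendsto_inverse filterlim_compose[OF qfact_LIMSEQ] qpoch_inf_self_nonzero assms)
  moreover have "\<forall>\<^sub>F N in sequentially. inverse (qfact Q (nat (f N))) = inv_qfact Q (f N)"
    using filterlim_at_top[THEN iffD1, OF assms(2), rule_format, of 0]
    by eventually_elim (simp add: inv_qfact_def)
  ultimately show ?thesis
    by (rule Lim_transform_eventually)
qed

lemma central_qbinom_LIMSEQ:
  assumes "norm Q < 1"
  shows "(\<lambda>N. central_qbinom Q N m) \<longlonglongrightarrow> inverse (qpoch_inf Q Q)"
proof -
  have shift: "filterlim (\<lambda>N. int N + c) at_top sequentially" for c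
    unfolding filterlim_at_top
  proof
    fix Z
    show "\<forall>\<^sub>F N in sequentially. Z \<le> int N + c"
      using eventually_ge_at_top[of "nat (Z - c)"] by eventually_elim auto
  qed
  hence "filterlim (\<lambda>N. int N + m) at_top sequentially" "filterlim (\<lambda>N. int N - m) at_top sequentially"
    using shift[of "- m"] by simp_all
  moreover have "(\<lambda>N. qfact Q (2 * N)) \<longlonglongrightarrow> qpoch_inf Q Q"
    using LIMSEQ_subseq_LIMSEQ[OF qfact_LIMSEQ[OF assms], of "\<lambda>N. 2 * N"]
    by (simp add: o_def strict_mono_def)
  ultimately have "(\<lambda>N. central_qbinom Q N m) \<longlonglongrightarrow>
      qpoch_inf Q Q * inverse (qpoch_inf Q Q) * inverse (qpoch_inf Q Q)"
    unfolding central_qbinom_def by (intro tendsto_mult inv_qfact_LIMSEQ assms)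
  thus ?thesis
    using qpoch_inf_self_nonzero[OF assms] by simp
qed

text \<open>\<open>qfact\<close> and its reciprocal both converge, the limit being nonzero, hence
  are bounded. Uniformity in \<open>N\<close> and \<open>m\<close> is what the majorant
  requires.\<close>

lemma central_qbinom_bounded:
  assumes "norm Q < 1"
  obtains C where "C \<ge> 0" "\<And>N m. norm (central_qbinom Q N m) \<le> C"
proof -
  obtain K where K: "K > 0" "\<And>n. norm (qfact Q n) \<le> K"
    using convergent_imp_Bseq[OF convergentI[OF qfact_LIMSEQ[OF assms]]] by (auto simp: Bseq_def)
  have "(\<lambda>n. inverse (qfact Q n)) \<longlonglongrightarrow> inverse (qpoch_inf Q Q)"
    by (intro tendsto_inverse qfact_LIMSEQ qpoch_inf_self_nonzero assms)
  hence "Bseq (\<lambda>n. inverse (qfact Q n))"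
    by (intro convergent_imp_Bseq convergentI)
  then obtain L where L: "L > 0" "\<And>n. norm (inverse (qfact Q n)) \<le> L"
    by (auto simp: Bseq_def)
  have L': "norm (inv_qfact Q n) \<le> L" for n
    using L by (auto simp: inv_qfact_def less_imp_le)
  have "norm (central_qbinom Q N m) \<le> K * L * L" for N m
    unfolding central_qbinom_def norm_mult using K L L'
    by (intro mult_mono) auto
  moreover have "K * L * L \<ge> 0"
    using K L by simp
  ultimately show ?thesis
    using that by blast
qed

text \<open>Each binomial tends to the reciprocal of \<open>qpoch_inf Q Q\<close>, which is then
  multiplied across. \<open>F\<close> and \<open>G\<close> stay parameters so that the case
  \<open>x = 1\<close> is covered too.\<close>

lemma theta_limit:
  assumes Q: "Q \<noteq> 0" "norm Q < 1" and x: "x \<noteq> 0"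
  shows "triple_partial Q x \<longlonglongrightarrow> F \<Longrightarrow>
      ((\<lambda>m. theta_coeff Q m * x powi m) has_sum (F * qpoch_inf Q Q)) UNIV" (is "_ \<Longrightarrow> ?F")
    and "triple_partial_deriv Q x \<longlonglongrightarrow> G \<Longrightarrow>
      ((\<lambda>m. of_int m * (theta_coeff Q m * x powi m)) has_sum (G * qpoch_inf Q Q)) UNIV" (is "_ \<Longrightarrow> ?G")
proof -
  define t where "t m = theta_coeff Q m * x powi m" for m
  obtain C where C: "C \<ge> 0" "\<And>N m. norm (central_qbinom Q N m) \<le> C"
    using central_qbinom_bounded[OF Q(2)] by blast
  have M: "(\<lambda>m. C * ((1 + real_of_int \<bar>m\<bar>) * norm (t m))) summable_on UNIV"
    unfolding t_def by (intro summable_on_cmult_right theta_majorant_summable assms)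
  \<comment> \<open>\<open>w\<close> is 1 for the series and \<open>m\<close> for its
    derivative.\<close>
  have b: "norm (w * triple_term Q x N m) \<le> C * ((1 + real_of_int \<bar>m\<bar>) * norm (t m))"
    if "norm w \<le> 1 + real_of_int \<bar>m\<bar>" for w N m
  proof -
    have "norm (w * triple_term Q x N m) = norm (central_qbinom Q N m) * (norm w * norm (t m))"
      by (simp add: triple_term_def t_def norm_mult)
    also have "\<dots> \<le> C * ((1 + real_of_int \<bar>m\<bar>) * norm (t m))"
      using C that by (intro mult_mono mult_nonneg_nonneg) auto
    finally show ?thesis .
  qed
  have lim: "(\<lambda>N. w * triple_term Q x N m) \<longlonglongrightarrow> inverse (qpoch_inf Q Q) * (w * t m)" for w m
    using tendsto_mult_right[OF central_qbinom_LIMSEQ[OF Q(2)], of m "w * t m"]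
    by (simp add: triple_term_def t_def mult_ac)
  have cancel: "(f has_sum (S * qpoch_inf Q Q)) UNIV"
    if "((\<lambda>m. inverse (qpoch_inf Q Q) * f m) has_sum S) UNIV" for f :: "int \<Rightarrow> complex" and S
    using has_sum_cmult_right[OF that, of "qpoch_inf Q Q"] qpoch_inf_self_nonzero[OF Q(2)]
    by (simp add: mult.commute[of S] mult.assoc[symmetric])
  show ?F if "triple_partial Q x \<longlonglongrightarrow> F"
  proof -
    have "((\<lambda>m. inverse (qpoch_inf Q Q) * t m) has_sum F) UNIV"
      using lim[of 1] b[of 1] by (intro has_sum_limit_int[OF triple_partial_has_sum(1)[OF Q x] _ _ M that]) auto
    thus ?thesis
      unfolding t_def by (rule cancel)
  qed
  show ?G if "triple_partial_deriv Q x \<longlonglongrightarrow> G"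
  proof -
    have "((\<lambda>m. inverse (qpoch_inf Q Q) * (of_int m * t m)) has_sum G) UNIV"
      using lim b by (intro has_sum_limit_int[OF triple_partial_has_sum(2)[OF Q x] _ _ M that]) auto
    thus ?thesis
      unfolding t_def by (rule cancel)
  qed
qed

lemma triple_partial_LIMSEQ:
  assumes "norm Q < 1"
  shows "triple_partial Q x \<longlonglongrightarrow> qpoch_inf x Q * qpoch_inf (Q / x) Q"
  unfolding triple_partial_def[abs_def] prod.distrib
  by (intro tendsto_mult qpoch_inf_LIMSEQ assms)

lemma jacobi_triple_product:
  assumes "Q \<noteq> 0" "norm Q < 1" "x \<noteq> 0"
  shows "((\<lambda>m. theta_coeff Q m * x powi m) has_sum qpoch_infs [x, Q / x, Q] Q) UNIV"
  using theta_limit(1)[OF assms triple_partial_LIMSEQ] assms by (simp add: qpoch_infs_def mult.assoc)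

section \<open>The Lambert series as logarithmic derivative of the triple product\<close>

lemma power_mult_neq_one:
  fixes x Q :: complex
  assumes "norm x < 1" "norm Q < 1"
  shows "x * Q ^ j \<noteq> 1"
proof
  assume "x * Q ^ j = 1"
  hence "norm x * norm Q ^ j = 1"
    by (metis norm_mult norm_one norm_power)
  moreover have "norm x * norm Q ^ j \<le> norm x * 1"
    using assms by (intro mult_left_mono power_le_one) auto
  ultimately show False
    using assms by simp
qed

lemma summable_lambert:
  fixes x Q :: complex
  assumes "norm x < 1" "norm Q < 1"
  shows "summable (\<lambda>j. x * Q ^ j / (1 - x * Q ^ j))"
proof (rule summable_comparison_test)
  show "summable (\<lambda>j. norm x / (1 - norm x) * norm Q ^ j)"
    using assms by (intro summable_mult summable_geometric) auto
  have "norm (x * Q ^ j / (1 - x * Q ^ j)) \<le> norm x / (1 - norm x) * norm Q ^ j" for j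
  proof -
    have "norm x * norm Q ^ j \<le> norm x * 1"
      using assms by (intro mult_left_mono power_le_one) auto
    hence "1 - norm x \<le> norm (1 - x * Q ^ j)"
      using norm_triangle_ineq2[of 1 "x * Q ^ j"] by (simp add: norm_mult norm_power)
    hence "norm (x * Q ^ j) / norm (1 - x * Q ^ j) \<le> norm (x * Q ^ j) / (1 - norm x)"
      using assms by (intro divide_left_mono mult_pos_pos) auto
    thus ?thesis
      by (simp add: norm_divide norm_mult norm_power)
  qed
  thus "\<exists>N. \<forall>j\<ge>N. norm (x * Q ^ j / (1 - x * Q ^ j)) \<le> norm x / (1 - norm x) * norm Q ^ j"
    by blast
qed

text \<open>Both \<open>x\<close> and \<open>Q / x\<close> lie in the unit disc, so no factor
  vanishes and the derivative is the product times its logarithmic derivative.\<close>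

lemma jacobi_triple_product_log_deriv:
  fixes Q x :: complex
  assumes Q: "Q \<noteq> 0" "norm Q < 1" and x: "x \<noteq> 0" "norm x < 1" "norm (Q / x) < 1"
  shows "((\<lambda>m. of_int m * (theta_coeff Q m * x powi m)) has_sum
    (qpoch_infs [x, Q / x, Q] Q *
      (\<Sum>j. Q / x * Q ^ j / (1 - Q / x * Q ^ j) - x * Q ^ j / (1 - x * Q ^ j)))) UNIV"
proof -
  \<comment> \<open>\<open>x d/dx\<close> maps \<open>log (1 - x Q^j)\<close> and
    \<open>log (1 - Q^(j+1) / x)\<close> to the two fractions, signs included.\<close>
  define L where "L j = Q / x * Q ^ j / (1 - Q / x * Q ^ j) - x * Q ^ j / (1 - x * Q ^ j)" for j
  have deriv: "triple_partial_deriv Q x N = triple_partial Q x N * sum L {..<N}" for N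
  proof (induction N)
    case (Suc N)
    define u v where "u = x * Q ^ N" "v = Q / x * Q ^ N"
    have nz: "1 - v \<noteq> 0" "1 - u \<noteq> 0"
      using power_mult_neq_one[of x Q N] power_mult_neq_one[of "Q / x" Q N] Q x
      unfolding u_v_def by (metis eq_iff_diff_eq_0)+
    from nz have "v / (1 - v) - u / (1 - u) = (v * (1 - u) - u * (1 - v)) / ((1 - v) * (1 - u))"
      by (rule diff_frac_eq)
    hence "(1 - u) * (1 - v) * (v / (1 - v) - u / (1 - u)) = v * (1 - u) - u * (1 - v)"
      using nz by simp
    also have "\<dots> = v - u"
      by (simp add: algebra_simps)
    finally have "(1 - u) * (1 - v) * (v / (1 - v) - u / (1 - u)) = v - u" .
    hence LN: "(1 - u) * (1 - v) * L N = v - u"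
      by (simp add: L_def u_v_def)
    have "triple_partial_deriv Q x (Suc N) =
        triple_partial Q x N * (sum L {..<N} * ((1 - u) * (1 - v)) + (v - u))"
      using Suc.IH by (simp add: u_v_def algebra_simps)
    also have "\<dots> = triple_partial Q x N * ((1 - u) * (1 - v)) * (sum L {..<N} + L N)"
      unfolding LN[symmetric] by (simp add: algebra_simps)
    finally show ?case
      by (simp add: triple_partial_def u_v_def)
  qed (simp add: triple_partial_def)
  have "summable L"
    unfolding L_def by (intro summable_diff summable_lambert Q x)
  hence "triple_partial_deriv Q x \<longlonglongrightarrow> qpoch_inf x Q * qpoch_inf (Q / x) Q * suminf L"
    unfolding deriv[abs_def] by (intro tendsto_mult triple_partial_LIMSEQ Q summable_LIMSEQ)
  from theta_limit(2)[OF Q x(1) this] show ?thesis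
    unfolding L_def[symmetric] by (simp add: qpoch_infs_def mult_ac)
qed

section \<open>Jacobi's identity for the cube\<close>

definition jacobi_term :: "complex \<Rightarrow> int \<Rightarrow> complex" where
  "jacobi_term q n = (-1) powi n * of_int (2 * n + 1) * q powi (n * (n + 1) div 2)"

text \<open>The value at \<open>x = 1\<close> of the derivative of the triple product: only the derivative of the
  vanishing factor \<open>1 - x\<close> survives.\<close>

lemma jacobi_identity:
  assumes q: "q \<noteq> 0" "norm q < 1"
  shows "(jacobi_term q has_sum (2 * qpoch_inf q q ^ 3)) UNIV"
proof -
  \<comment> \<open>\<open>Suc N\<close> guarantees that the factor with \<open>j = 0\<close>, which
    is \<open>1 - 1\<close>, is present.\<close>
  have zero: "triple_partial q 1 (Suc N) = 0" for N
    unfolding triple_partial_def by (rule prod_zero) (auto intro: bexI[of _ 0])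
  \<comment> \<open>The vanishing factor has derivative -1. Without it the first product is
    \<open>qfact q N\<close>, while the second keeps all \<open>Suc N\<close> factors.\<close>
  have deriv: "triple_partial_deriv q 1 (Suc N) = - (qfact q N * qfact q (Suc N))" for N
  proof (induction N)
    case 0
    thus ?case by (simp add: qfact_def triple_partial_def)
  next
    case (Suc N)
    show ?case
      unfolding triple_partial_deriv.simps(2)[of _ _ "Suc N"] Suc.IH zero
      by (simp add: qfact_def)
  qed
  have "triple_partial q 1 \<longlonglongrightarrow> 0"
    by (rule LIMSEQ_imp_Suc) (simp add: zero)
  from theta_limit(1)[OF q _ this] have T: "(theta_coeff q has_sum 0) UNIV"
    by simp
  have "triple_partial_deriv q 1 \<longlonglongrightarrow> - (qpoch_inf q q * qpoch_inf q q)"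
    by (rule LIMSEQ_imp_Suc, unfold deriv)
       (intro tendsto_intros qfact_LIMSEQ LIMSEQ_Suc q)
  from theta_limit(2)[OF q _ this]
  have "((\<lambda>m. of_int m * theta_coeff q m) has_sum - (qpoch_inf q q ^ 3)) UNIV"
    by (simp add: power3_eq_cube)
  \<comment> \<open>The unweighted series has sum 0 and may be added. The weight
    \<open>1 - 2m\<close> is \<open>-(2n + 1)\<close> at \<open>m = n + 1\<close>, and its sign
    cancels against \<open>(-1)^(n+1)\<close>.\<close>
  hence "((\<lambda>m. (-2) * (of_int m * theta_coeff q m) + theta_coeff q m) has_sum
      ((-2) * - (qpoch_inf q q ^ 3) + 0)) UNIV"
    by (intro has_sum_add has_sum_cmult_right T)
  hence "((\<lambda>n. (-2) * (of_int (n + 1) * theta_coeff q (n + 1)) + theta_coeff q (n + 1)) has_sum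
      (2 * qpoch_inf q q ^ 3)) UNIV"
    by (subst has_sum_shift_int) simp
  also have "(\<lambda>n. (-2) * (of_int (n + 1) * theta_coeff q (n + 1)) + theta_coeff q (n + 1)) = jacobi_term q"
    by (rule ext) (simp add: jacobi_term_def theta_coeff_def power_int_add algebra_simps)
  finally show ?thesis .
qed

subsection \<open>Dissection modulo k\<close>

text \<open>\<open>n (n + 1)\<close> is symmetric about -1/2, while \<open>(-1)^n\<close> and
  \<open>2n + 1\<close> both change sign.\<close>

lemma jacobi_term_reflect: "jacobi_term q (- 1 - n) = jacobi_term q n"
proof -
  have "(-1 - n) * (-1 - n + 1) = n * (n + 1)"
    by (simp add: algebra_simps)
  moreover have "(-1 :: complex) powi (-1 - n) = - ((-1) powi n)"
    by (simp add: power_int_diff field_simps power_int_mult_distrib[symmetric])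
  moreover have "of_int (2 * (-1 - n) + 1) = - (of_int (2 * n + 1) :: complex)"
    by simp
  ultimately show ?thesis
    unfolding jacobi_term_def by (metis minus_mult_minus)
qed

text \<open>Division with remainder is a bijection from Z to pairs of residue and quotient;
  unconditional summation permits the regrouping.\<close>

lemma has_sum_residue_classes:
  fixes f :: "int \<Rightarrow> complex"
  assumes f: "(f has_sum S) UNIV" and k: "k > 0"
  shows "\<And>r. (\<lambda>m. f (int k * m + int r)) summable_on UNIV"
    and "(\<Sum>r<k. \<Sum>\<^sub>\<infinity>m. f (int k * m + int r)) = S"
proof -
  show summable: "(\<lambda>m. f (int k * m + int r)) summable_on UNIV" for r
  proof -
    have "f summable_on range (\<lambda>m. int k * m + int r)"
      using f by (meson has_sum_imp_summable subset_UNIV summable_on_subset_banach)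
    thus ?thesis
      using k by (subst (asm) summable_on_reindex) (auto simp: inj_on_def o_def)
  qed
  have "((\<lambda>(r, m). f (int k * m + int r)) has_sum S) ({..<k} \<times> UNIV) \<longleftrightarrow> (f has_sum S) UNIV"
    using k
    by (intro has_sum_reindex_bij_witness[where i = "\<lambda>n. (nat (n mod int k), n div int k)"
          and j = "\<lambda>(r, m). int k * m + int r"]) (auto simp: nat_less_iff)
  with f have "((\<lambda>(r, m). f (int k * m + int r)) has_sum S) ({..<k} \<times> UNIV)"
    by simp
  hence "((\<lambda>r. \<Sum>\<^sub>\<infinity>m. f (int k * m + int r)) has_sum S) {..<k}"
    by (rule has_sum_SigmaD) (use summable in auto)
  thus "(\<Sum>r<k. \<Sum>\<^sub>\<infinity>m. f (int k * m + int r)) = S"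
    by (simp add: has_sum_finite_iff)
qed

text \<open>The reflection swaps the residues below and above \<open>(k - 1) / 2\<close>; a fixed
  residue exists only for odd \<open>k\<close>.\<close>

lemma sum_reflect_halves:
  fixes T :: "nat \<Rightarrow> complex"
  assumes "\<And>r. r < k \<Longrightarrow> T (k - 1 - r) = T r"
  shows "(\<Sum>r<k. T r) = 2 * (\<Sum>l | 2 * l < k - 1. T l) + (if odd k then T ((k - 1) div 2) else 0)"
proof -
  let ?A = "{l. 2 * l < k - 1}" and ?B = "{r. r < k \<and> k - 1 < 2 * r}" and ?C = "{r. r < k \<and> 2 * r = k - 1}"
  have fin: "finite ?A" "finite ?B" "finite ?C"
    by (rule finite_subset[of _ "{..<k}"]; auto)+
  have "(\<Sum>r\<in>?B. T r) = (\<Sum>l\<in>?A. T l)"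
    by (rule sum.reindex_bij_witness[where i = "\<lambda>l. k - 1 - l" and j = "\<lambda>r. k - 1 - r"])
       (use assms in auto)
  moreover have "(\<Sum>r\<in>?C. T r) = (if odd k then T ((k - 1) div 2) else 0)"
  proof (cases "odd k")
    case True
    hence "?C = {(k - 1) div 2}"
      by (auto elim!: oddE)
    thus ?thesis using True by simp
  next
    case False
    hence "?C = {}"
      by auto presburger
    show ?thesis
      unfolding \<open>?C = {}\<close> using False by simp
  qed
  moreover have "{..<k} = ?A \<union> ?B \<union> ?C"
    by auto
  moreover have "sum T (?A \<union> ?B \<union> ?C) = sum T ?A + sum T ?B + sum T ?C"
  proof -
    have "sum T (?A \<union> ?B \<union> ?C) = sum T (?A \<union> ?B) + sum T ?C"
      using fin by (intro sum.union_disjoint) auto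
    also have "sum T (?A \<union> ?B) = sum T ?A + sum T ?B"
      using fin by (intro sum.union_disjoint) auto
    finally show ?thesis .
  qed
  ultimately show ?thesis
    by simp
qed

section \<open>Exponents and sums of the residue classes\<close>

lemma two_times_half:
  fixes n :: int
  shows "2 * (n * (n + 1) div 2) = n * (n + 1)" and "2 * (n * (n - 1) div 2) = n * (n - 1)"
  by simp_all

lemma two_times_exp_plus: "2 * exp_plus k l = k * (k + 1 + 2 * l)"
  unfolding exp_plus_def by simp

text \<open>This makes the two triple product arguments complementary: up to sign they are
  \<open>x\<close> and \<open>Q / x\<close> for \<open>Q = q^(k^2)\<close>.\<close>

lemma exp_plus_minus:
  assumes "2 * l < k - 1"
  shows "exp_plus k l + exp_minus k l = k ^ 2"
proof -
  obtain d where d: "k = d + 1 + 2 * l"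
    using assms by (metis add.assoc add.commute le_add_diff_inverse less_imp_le_nat less_diff_conv)
  \<comment> \<open>\<open>k\<close> and \<open>d\<close> differ by the odd number
    \<open>1 + 2l\<close>, so their product is even and the halving exact.\<close>
  have "2 * exp_minus k l = k * (k - 1 - 2 * l)"
    unfolding exp_minus_def using assms by (simp add: d)
  hence "2 * (exp_plus k l + exp_minus k l) = k * ((k + 1 + 2 * l) + (k - 1 - 2 * l))"
    using two_times_exp_plus[of k l] by (simp only: distrib_left)
  also have "(k + 1 + 2 * l) + (k - 1 - 2 * l) = 2 * k"
    using assms by simp
  finally show ?thesis
    by (simp add: power2_eq_square)
qed

lemma exp_minus_pos:
  assumes "2 * l < k - 1"
  shows "exp_minus k l > 0"
proof -
  have "2 * 1 \<le> k * (k - 1 - 2 * l)"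
    using assms by (intro mult_le_mono) auto
  thus ?thesis
    unfolding exp_minus_def by simp
qed

text \<open>Expanding at \<open>n = km + l\<close> gives a theta series with base
  \<open>q^(k^2)\<close>. The sign is \<open>(-1)^(km) = (-1)^m (-(-1)^k)^m\<close>, and the weight
  \<open>2n + 1\<close> is linear in \<open>m\<close>.\<close>

lemma jacobi_term_residue:
  fixes q :: complex
  assumes q: "q \<noteq> 0"
  shows "jacobi_term q (int k * m + int l) =
    (-1) ^ l * q ^ (l * (l + 1) div 2) * (2 * of_nat l + 1 + 2 * of_nat k * of_int m) *
    (theta_coeff (q ^ k\<^sup>2) m * (- ((-1) ^ k) * q ^ exp_plus k l) powi m)"
proof -
  define n where "n = int k * m + int l"
  \<comment> \<open>Doubling removes the divisions, which are all exact.\<close>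
  have "2 * (n * (n + 1) div 2) =
      2 * (int (l * (l + 1) div 2) + int (k\<^sup>2) * (m * (m - 1) div 2) + int (exp_plus k l) * m)"
  proof -
    have "2 * int (l * (l + 1) div 2) = int l * (int l + 1)"
      using two_times_half(1)[of "int l"] by (simp add: zdiv_int algebra_simps)
    moreover have "2 * int (exp_plus k l) = int k * (int k + 1 + 2 * int l)"
      using arg_cong[OF two_times_exp_plus[of k l], of int] by (simp add: algebra_simps)
    moreover have "2 * (int (k\<^sup>2) * (m * (m - 1) div 2)) = int (k\<^sup>2) * (m * (m - 1))"
      by (metis two_times_half(2) mult.left_commute)
    ultimately show ?thesis
      unfolding two_times_half distrib_left[of 2] n_def
      by (simp add: mult.assoc[symmetric, of 2]) (simp add: power2_eq_square algebra_simps)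
  qed
  hence "q powi (n * (n + 1) div 2) =
      q ^ (l * (l + 1) div 2) * (q ^ k\<^sup>2) powi (m * (m - 1) div 2) * (q ^ exp_plus k l) powi m"
    using q by (simp add: power_int_add power_int_mult power_int_of_nat del: of_nat_power)
  moreover have "(-1 :: complex) powi n = (-1) ^ l * ((-1) powi m * (- ((-1) ^ k)) powi m)"
    unfolding n_def power_int_mult_distrib[symmetric]
    by (simp add: power_int_add power_int_mult power_int_of_nat)
  ultimately show ?thesis
    unfolding jacobi_term_def theta_coeff_def n_def[symmetric] power_int_mult_distrib
    by (simp add: n_def algebra_simps)
qed

text \<open>The sign \<open>s\<close> is -1 for even and 1 for odd \<open>k\<close>, so both
  parities are treated at once.\<close>

lemma residue_class_sum:
  fixes q :: complex
  assumes q: "q \<noteq> 0" "norm q < 1" and l: "2 * l < k - 1"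
  defines "s \<equiv> - ((-1) ^ k)" and "Q \<equiv> q ^ k\<^sup>2"
  shows "(\<Sum>\<^sub>\<infinity>m. jacobi_term q (int k * m + int l)) =
    (-1) ^ l * q ^ (l * (l + 1) div 2) *
    qpoch_infs [s * q ^ exp_minus k l, s * q ^ exp_plus k l, Q] Q *
    (2 * of_nat l + 1 + 2 * of_nat k *
      (\<Sum>n. s * q ^ (k\<^sup>2 * n + exp_minus k l) / (1 - s * q ^ (k\<^sup>2 * n + exp_minus k l))
          - s * q ^ (k\<^sup>2 * n + exp_plus k l) / (1 - s * q ^ (k\<^sup>2 * n + exp_plus k l))))"
proof -
  define x y where "x = s * q ^ exp_plus k l" "y = s * q ^ exp_minus k l"
  note xy = this
  have s: "s * s = 1" "norm s = 1"
    unfolding s_def by (simp_all add: norm_power flip: power_mult_distrib)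
  have k: "k > 0"
    using l by simp
  have plus_pos: "exp_plus k l > 0"
    using two_times_exp_plus[of k l] k by (intro Nat.gr0I) simp
  have Q: "Q \<noteq> 0" "norm Q < 1"
    using q k unfolding Q_def by (auto simp: norm_power power_less_one_iff)
  have "x * y = Q"
    using s unfolding xy Q_def exp_plus_minus[OF l, symmetric] power_add
    by (simp add: algebra_simps)
  moreover have x: "x \<noteq> 0" "norm x < 1"
    using q s plus_pos unfolding xy by (auto simp: norm_mult norm_power power_less_one_iff)
  ultimately have y: "Q / x = y"
    by auto
  have "norm (Q / x) < 1"
    unfolding y unfolding xy using q s exp_minus_pos[OF l]
    by (auto simp: norm_mult norm_power power_less_one_iff)
  note F = jacobi_triple_product[OF Q x(1)] and G = jacobi_triple_product_log_deriv[OF Q x this]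
  let ?F = "qpoch_infs [x, y, Q] Q"
  let ?L = "\<Sum>n. y * Q ^ n / (1 - y * Q ^ n) - x * Q ^ n / (1 - x * Q ^ n)"
  \<comment> \<open>The weight \<open>(2l + 1) + 2km\<close> splits the class into the triple
    product series and \<open>2k\<close> times its derivative.\<close>
  have "((\<lambda>m. (-1) ^ l * q ^ (l * (l + 1) div 2) * ((2 * of_nat l + 1) * (theta_coeff Q m * x powi m)
        + 2 * of_nat k * (of_int m * (theta_coeff Q m * x powi m)))) has_sum
      ((-1) ^ l * q ^ (l * (l + 1) div 2) * ((2 * of_nat l + 1) * ?F + 2 * of_nat k * (?F * ?L)))) UNIV"
    using F G unfolding y by (intro has_sum_cmult_right has_sum_add)
  also have "(\<lambda>m. (-1) ^ l * q ^ (l * (l + 1) div 2) * ((2 * of_nat l + 1) * (theta_coeff Q m * x powi m)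
        + 2 * of_nat k * (of_int m * (theta_coeff Q m * x powi m))))
      = (\<lambda>m. jacobi_term q (int k * m + int l))"
    unfolding jacobi_term_residue[OF q(1)] x_y_def s_def Q_def by (simp add: algebra_simps)
  finally have "(\<Sum>\<^sub>\<infinity>m. jacobi_term q (int k * m + int l)) =
      (-1) ^ l * q ^ (l * (l + 1) div 2) * ?F * (2 * of_nat l + 1 + 2 * of_nat k * ?L)"
    by (simp add: infsumI algebra_simps)
  moreover have "y * Q ^ n = s * q ^ (k\<^sup>2 * n + exp_minus k l)"
    "x * Q ^ n = s * q ^ (k\<^sup>2 * n + exp_plus k l)" for n
    by (simp_all add: xy Q_def power_add power_mult)
  moreover have "?F = qpoch_infs [y, x, Q] Q"
    by (simp add: qpoch_infs_def)
  ultimately show ?thesis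
    by (simp only: xy)
qed

text \<open>For \<open>n = km + (k - 1) / 2\<close> one has \<open>2n + 1 = k (2m + 1)\<close>, so
  this class is a multiple of the Jacobi sum with base \<open>q^(k^2)\<close>.\<close>

lemma middle_class_sum:
  fixes q :: complex
  assumes q: "q \<noteq> 0" "norm q < 1" and k: "odd k"
  shows "(\<Sum>\<^sub>\<infinity>m. jacobi_term q (int k * m + int ((k - 1) div 2))) =
    2 * ((-1) ^ ((k - 1) div 2) * of_nat k * q ^ ((k\<^sup>2 - 1) div 8) * qpoch_inf (q ^ k\<^sup>2) (q ^ k\<^sup>2) ^ 3)"
proof -
  obtain l where l: "k = 2 * l + 1"
    using k by (auto elim: oddE)
  let ?Q = "q ^ k\<^sup>2"
  have Q: "?Q \<noteq> 0" "norm ?Q < 1"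
    using q l by (auto simp: norm_power power_less_one_iff)
  have "k\<^sup>2 - 1 = 4 * (l * (l + 1))"
    by (simp add: l power2_eq_square)
  \<comment> \<open>The product \<open>l (l + 1)\<close> is even, so 8 divides
    \<open>k^2 - 1\<close> and both divisions are exact.\<close>
  hence exp: "(k\<^sup>2 - 1) div 8 = l * (l + 1) div 2"
    by simp
  have "jacobi_term q (int k * m + int l) =
      (-1) ^ l * of_nat k * q ^ ((k\<^sup>2 - 1) div 8) * jacobi_term ?Q m" for m
  proof -
    define n where "n = int k * m + int l"
    have "n * (n + 1) = int l * (int l + 1) + int (k\<^sup>2) * (m * (m + 1))"
      by (simp add: n_def l power2_eq_square) algebra
    hence "2 * (n * (n + 1) div 2) = 2 * (int (l * (l + 1) div 2) + int (k\<^sup>2) * (m * (m + 1) div 2))"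
      unfolding distrib_left[of 2] mult.left_commute[of 2 "int (k\<^sup>2)"] two_times_half
      using two_times_half(1)[of "int l"] by (simp add: zdiv_int algebra_simps)
    hence "q powi (n * (n + 1) div 2) = q ^ (l * (l + 1) div 2) * ?Q powi (m * (m + 1) div 2)"
      using q by (simp add: power_int_add power_int_mult power_int_of_nat del: of_nat_power)
    moreover have "(-1 :: complex) powi n = (-1) ^ l * (-1) powi m"
      using k by (simp add: n_def power_int_add power_int_mult power_int_of_nat)
    moreover have "of_int (2 * n + 1) = of_nat k * (of_int (2 * m + 1) :: complex)"
      by (simp add: n_def l algebra_simps)
    ultimately show ?thesis
      unfolding jacobi_term_def exp n_def[symmetric] by simp
  qed
  hence "((\<lambda>m. jacobi_term q (int k * m + int l)) has_sum
      ((-1) ^ l * of_nat k * q ^ ((k\<^sup>2 - 1) div 8) * (2 * qpoch_inf ?Q ?Q ^ 3))) UNIV"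
    by (simp only: has_sum_cmult_right[OF jacobi_identity[OF Q]])
  thus ?thesis
    by (simp add: infsumI l)
qed

lemma qpoch_cube_dissection:
  fixes q :: complex
  assumes q: "q \<noteq> 0" "norm q < 1" and k: "k > 0"
  shows "qpoch_inf q q ^ 3 =
    (\<Sum>l | 2 * l < k - 1. \<Sum>\<^sub>\<infinity>m. jacobi_term q (int k * m + int l))
    + (if odd k then (-1) ^ ((k - 1) div 2) * of_nat k * q ^ ((k\<^sup>2 - 1) div 8)
        * qpoch_inf (q ^ k\<^sup>2) (q ^ k\<^sup>2) ^ 3 else 0)"
proof -
  define T where "T r = (\<Sum>\<^sub>\<infinity>m. jacobi_term q (int k * m + int r))" for r
  have "T (k - 1 - r) = T r" if "r < k" for r
  proof -
    \<comment> \<open>The reflection \<open>n \<mapsto> -1 - n\<close> acts as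
      \<open>m \<mapsto> -1 - m\<close> on quotients and \<open>r \<mapsto> k - 1 - r\<close> on
      residues.\<close>
    have "jacobi_term q (int k * (- 1 - m) + int (k - 1 - r)) = jacobi_term q (int k * m + int r)" for m
    proof -
      have "int k * (- 1 - m) + int (k - 1 - r) = - 1 - (int k * m + int r)"
        using that by (simp add: of_nat_diff algebra_simps)
      thus ?thesis
        by (simp only: jacobi_term_reflect)
    qed
    moreover have "bij (\<lambda>m :: int. - 1 - m)"
      by (rule bijI'[OF _ _]) (auto intro: exI[of _ "- 1 - _"])
    ultimately show ?thesis
      unfolding T_def
      using infsum_reindex_bij_betw[of "\<lambda>m. - 1 - m" UNIV UNIV
          "\<lambda>m. jacobi_term q (int k * m + int (k - 1 - r))"] by simp
  qed
  from sum_reflect_halves[of k T, OF this]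
  have "2 * qpoch_inf q q ^ 3 =
      2 * (\<Sum>l | 2 * l < k - 1. T l) + (if odd k then T ((k - 1) div 2) else 0)"
    using has_sum_residue_classes(2)[OF jacobi_identity[OF q] k] by (simp add: T_def)
  thus ?thesis
    using middle_class_sum[OF q, of k] unfolding T_def
    by (cases "odd k") (simp_all only: if_True if_False mult_cancel_left distrib_left[symmetric] add_0_right
        zero_neq_numeral[symmetric] simp_thms refl)
qed

section \<open>The two parities of \<open>k\<close>\<close>

theorem theorem4p1:
  fixes q :: complex and k :: nat
  assumes "0 < norm q" and "norm q < 1" and "k > 0"
  shows "(even k \<longrightarrow>
      qpoch_inf q q ^ 3 =
        (\<Sum>l | 2 * l < k - 1. (-1) ^ l * q ^ (l * (l + 1) div 2) *
          qpoch_infs [- (q ^ exp_minus k l), - (q ^ exp_plus k l), q ^ (k ^ 2)] (q ^ (k ^ 2)) *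
          (2 * of_nat l + 1 - 2 * of_nat k *
            (\<Sum>n. q ^ (k ^ 2 * n + exp_minus k l) / (1 + q ^ (k ^ 2 * n + exp_minus k l))
                - q ^ (k ^ 2 * n + exp_plus k l) / (1 + q ^ (k ^ 2 * n + exp_plus k l)))))) \<and>
    (odd k \<longrightarrow>
      qpoch_inf q q ^ 3
        - (-1) ^ ((k - 1) div 2) * of_nat k * q ^ ((k ^ 2 - 1) div 8)
            * qpoch_inf (q ^ (k ^ 2)) (q ^ (k ^ 2)) ^ 3 =
        (\<Sum>l | 2 * l < k - 1. (-1) ^ l * q ^ (l * (l + 1) div 2) *
          qpoch_infs [q ^ exp_minus k l, q ^ exp_plus k l, q ^ (k ^ 2)] (q ^ (k ^ 2)) *
          (2 * of_nat l + 1 + 2 * of_nat k *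
            (\<Sum>n. q ^ (k ^ 2 * n + exp_minus k l) / (1 - q ^ (k ^ 2 * n + exp_minus k l))
                - q ^ (k ^ 2 * n + exp_plus k l) / (1 - q ^ (k ^ 2 * n + exp_plus k l))))))"
proof -
  have q: "q \<noteq> 0" "norm q < 1"
    using assms by auto
  note dissection = qpoch_cube_dissection[OF q assms(3)]
  \<comment> \<open>For \<open>s = -1\<close> the Lambert terms appear negated. Pulling the sign out
    of \<open>suminf\<close> requires summability.\<close>
  have even_lambert: "(\<Sum>n. q ^ (k ^ 2 * n + exp_plus k l) / (1 + q ^ (k ^ 2 * n + exp_plus k l))
        - q ^ (k ^ 2 * n + exp_minus k l) / (1 + q ^ (k ^ 2 * n + exp_minus k l)))
      = - (\<Sum>n. q ^ (k ^ 2 * n + exp_minus k l) / (1 + q ^ (k ^ 2 * n + exp_minus k l))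
        - q ^ (k ^ 2 * n + exp_plus k l) / (1 + q ^ (k ^ 2 * n + exp_plus k l)))"
    if l: "2 * l < k - 1" for l
  proof -
    have summable: "summable (\<lambda>n. q ^ (k ^ 2 * n + e) / (1 + q ^ (k ^ 2 * n + e)))" if "e > 0" for e
    proof -
      \<comment> \<open>The Lambert series at \<open>x = -(q^e)\<close>, of norm below 1 because
        \<open>e > 0\<close>.\<close>
      have "summable (\<lambda>n. - (- (q ^ e) * (q ^ k\<^sup>2) ^ n / (1 - - (q ^ e) * (q ^ k\<^sup>2) ^ n)))"
        using q assms that
        by (intro summable_minus summable_lambert) (auto simp: norm_power power_less_one_iff)
      thus ?thesis
        by (simp add: power_add power_mult mult.commute[of _ "q ^ e"])
    qed
    have "exp_plus k l > 0"
      using two_times_exp_plus[of k l] assms by (intro Nat.gr0I) simp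
    thus ?thesis
      using exp_minus_pos[OF l] by (subst suminf_minus[symmetric]) (auto intro!: summable_diff summable)
  qed
  show ?thesis
  proof (intro conjI impI)
    assume "even k"
    show "qpoch_inf q q ^ 3 =
        (\<Sum>l | 2 * l < k - 1. (-1) ^ l * q ^ (l * (l + 1) div 2) *
          qpoch_infs [- (q ^ exp_minus k l), - (q ^ exp_plus k l), q ^ (k ^ 2)] (q ^ (k ^ 2)) *
          (2 * of_nat l + 1 - 2 * of_nat k *
            (\<Sum>n. q ^ (k ^ 2 * n + exp_minus k l) / (1 + q ^ (k ^ 2 * n + exp_minus k l))
                - q ^ (k ^ 2 * n + exp_plus k l) / (1 + q ^ (k ^ 2 * n + exp_plus k l)))))"
      using \<open>even k\<close> unfolding dissection
      by (simp add: residue_class_sum[OF q] even_lambert)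
  next
    assume "odd k"
    thus "qpoch_inf q q ^ 3
        - (-1) ^ ((k - 1) div 2) * of_nat k * q ^ ((k ^ 2 - 1) div 8)
            * qpoch_inf (q ^ (k ^ 2)) (q ^ (k ^ 2)) ^ 3 =
        (\<Sum>l | 2 * l < k - 1. (-1) ^ l * q ^ (l * (l + 1) div 2) *
          qpoch_infs [q ^ exp_minus k l, q ^ exp_plus k l, q ^ (k ^ 2)] (q ^ (k ^ 2)) *
          (2 * of_nat l + 1 + 2 * of_nat k *
            (\<Sum>n. q ^ (k ^ 2 * n + exp_minus k l) / (1 - q ^ (k ^ 2 * n + exp_minus k l))
                - q ^ (k ^ 2 * n + exp_plus k l) / (1 - q ^ (k ^ 2 * n + exp_plus k l)))))"
      unfolding dissection by (simp add: residue_class_sum[OF q])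
  qed
qed

end
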